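(* Let $F_2$ be the field with two elements, $p_i$ the $i$-th prime, $\alpha_i$ a generator of the multiplicative group of the finite field $F_{2^{p_i}}$, and $P_i(X)\in F_2[X]$ the minimal polynomial of $\alpha_i$ over $F_2$. Let $A=F_2[X,X^{-1}]$ be the ring of Laurent polynomials and identify the lamplighter group $G=(\mathbb{Z}/2\mathbb{Z})\wr\mathbb{Z}$ with the subgroup $$G=\left\{\begin{pmatrix}X^n&P\\0&1\end{pmatrix}:P\in A,\ n\in\mathbb{Z}\right\}$$ of $GL_2(A)$. For $k\geq 1$ let $I_k$ be the ideal of $A$ generated by the product $P_1P_2\cdots P_k$, and let $N_k=G\cap\ker(GL_2(A)\to GL_2(A/I_k))$; the family $(N_k)_{k>0}$ is a filtration of $G$. Then the box space $\square_{(N_k)}G$ has property $D_{1/2}$.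
   Context: A filtration of a finitely generated residually finite group $G$ is a decreasing sequence $(N_k)_{k>0}$ of finite index normal subgroups of $G$ with trivial intersection. Fix a finite generating set $S$ of $G$ (here e.g. $\begin{pmatrix}X^{\pm1}&0\\0&1\end{pmatrix},\begin{pmatrix}1&1\\0&1\end{pmatrix}$) and view each $G/N_k$ as a Cayley graph (with its word metric) with respect to the image of $S$. The box space $\square_{(N_k)}G$ is the coarse disjoint union of the components $G/N_k$. For $\alpha\in(0,1]$, $\square_{(N_k)}G$ has property $D_\alpha$ if there exists $K>0$ such that $\mathrm{diam}(G/N)\ge K\,|G/N|^\alpha$ for every component $G/N$ of $\square_{(N_k)}G$. *)

theory Defs
  imports
    "HOL-Analysis.Analysis"
    "HOL-Algebra.Multiplicative_Group"
    "HOL-Algebra.Algebraic_Closure_Type"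
    "HOL-Library.Z2"
    "HOL-Library.Poly_Mapping"
    "HOL-Library.Infinite_Set"
    "HOL-Computational_Algebra.Primes"
    "HOL-Computational_Algebra.Polynomial"
begin

section \<open>Coarse geometry of finite quotients\<close>

definition filtration :: "('g, 'b) monoid_scheme \<Rightarrow> (nat \<Rightarrow> 'g set) \<Rightarrow> bool" where
  "filtration G N \<longleftrightarrow>
     (\<forall>k>0. N k \<lhd> G \<and> finite (carrier (G Mod N k)) \<and> N (Suc k) \<subseteq> N k) \<and>
     (\<Inter>k\<in>{0<..}. N k) = {\<one>\<^bsub>G\<^esub>}"

text \<open>Meaningful for elements of the subgroup generated by \<open>T\<close>.\<close>

definition word_length :: "('g, 'b) monoid_scheme \<Rightarrow> 'g set \<Rightarrow> 'g \<Rightarrow> nat" where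
  "word_length H T g =
     (LEAST n. \<exists>ws. length ws = n \<and> set ws \<subseteq> T \<union> m_inv H ` T \<and>
                    foldr (monoid.mult H) ws \<one>\<^bsub>H\<^esub> = g)"

definition word_dist :: "('g, 'b) monoid_scheme \<Rightarrow> 'g set \<Rightarrow> 'g \<Rightarrow> 'g \<Rightarrow> real" where
  "word_dist H T x y = real (word_length H T (inv\<^bsub>H\<^esub> x \<otimes>\<^bsub>H\<^esub> y))"

text \<open>
  \<open>d\<close> is a metric on the disjoint union of the \<open>Y k\<close>, for \<open>k > 0\<close>, which restricts to
  \<open>e k\<close> on \<open>Y k\<close> and for which the distance between different components tends to infinity.
  Such a metric is determined by the components only up to coarse equivalence.
\<close>

definition coarse_disjoint_union ::
    "(nat \<Rightarrow> 'p set) \<Rightarrow> (nat \<Rightarrow> 'p \<Rightarrow> 'p \<Rightarrow> real) \<Rightarrow> (nat \<times> 'p \<Rightarrow> nat \<times> 'p \<Rightarrow> real) \<Rightarrow> bool" where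
  "coarse_disjoint_union Y e d \<longleftrightarrow>
     Metric_space (SIGMA k:{0<..}. Y k) d \<and>
     (\<forall>k>0. \<forall>x\<in>Y k. \<forall>y\<in>Y k. d (k, x) (k, y) = e k x y) \<and>
     (\<forall>r. finite {(k, l). 0 < k \<and> 0 < l \<and> k \<noteq> l \<and>
                         (\<exists>x\<in>Y k. \<exists>y\<in>Y l. d (k, x) (l, y) \<le> r)})"

definition box_space ::
    "('g, 'b) monoid_scheme \<Rightarrow> 'g set \<Rightarrow> (nat \<Rightarrow> 'g set) \<Rightarrow>
     (nat \<times> 'g set \<Rightarrow> nat \<times> 'g set \<Rightarrow> real) \<Rightarrow> bool" where
  "box_space G S N d \<longleftrightarrow>
     coarse_disjoint_union
       (\<lambda>k. carrier (G Mod N k))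
       (\<lambda>k. word_dist (G Mod N k) ((\<lambda>s. N k #>\<^bsub>G\<^esub> s) ` S)) d"

definition metric_diam :: "('p \<Rightarrow> 'p \<Rightarrow> real) \<Rightarrow> 'p set \<Rightarrow> real" where
  "metric_diam d C = (SUP (x, y)\<in>C \<times> C. d x y)"

definition property_D :: "real \<Rightarrow> (nat \<Rightarrow> 'p set) \<Rightarrow> (nat \<times> 'p \<Rightarrow> nat \<times> 'p \<Rightarrow> real) \<Rightarrow> bool" where
  "property_D a Y d \<longleftrightarrow>
     (\<exists>K>0. \<forall>k>0. metric_diam d ({k} \<times> Y k) \<ge> K * real (card ({k} \<times> Y k)) powr a)"


section \<open>Two by two matrices over a ring\<close>

definition mat2_monoid :: "('a, 'b) ring_scheme \<Rightarrow> ('a ^ 2 ^ 2) monoid" where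
  "mat2_monoid R =
     \<lparr>carrier = {M. \<forall>i j. M $ i $ j \<in> carrier R},
      monoid.mult = (\<lambda>M N. \<chi> i j. \<Oplus>\<^bsub>R\<^esub>k\<in>UNIV. M $ i $ k \<otimes>\<^bsub>R\<^esub> N $ k $ j),
      one = (\<chi> i j. if i = j then \<one>\<^bsub>R\<^esub> else \<zero>\<^bsub>R\<^esub>)\<rparr>"

definition GL2 :: "('a, 'b) ring_scheme \<Rightarrow> ('a ^ 2 ^ 2) monoid" where
  "GL2 R = units_of (mat2_monoid R)"

definition mat2_mod :: "('a, 'b) ring_scheme \<Rightarrow> 'a set \<Rightarrow> 'a ^ 2 ^ 2 \<Rightarrow> 'a set ^ 2 ^ 2" where
  "mat2_mod R I M = (\<chi> i j. I +>\<^bsub>R\<^esub> (M $ i $ j))"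


section \<open>Polynomials over the field with two elements\<close>

definition F2_embed :: "('a, 'b) ring_scheme \<Rightarrow> bit \<Rightarrow> 'a" where
  "F2_embed K c = (if c = 0 then \<zero>\<^bsub>K\<^esub> else \<one>\<^bsub>K\<^esub>)"

definition F2_eval :: "('a, 'b) ring_scheme \<Rightarrow> bit poly \<Rightarrow> 'a \<Rightarrow> 'a" where
  "F2_eval K p x =
     (\<Oplus>\<^bsub>K\<^esub>i\<in>{..Polynomial.degree p}. F2_embed K (Polynomial.coeff p i) \<otimes>\<^bsub>K\<^esub> x [^]\<^bsub>K\<^esub> i)"

text \<open>To be used for fields \<open>K\<close> of characteristic two, where \<open>F2_embed K\<close> is a homomorphism.\<close>

definition is_minimal_poly :: "('a, 'b) ring_scheme \<Rightarrow> 'a \<Rightarrow> bit poly \<Rightarrow> bool" where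
  "is_minimal_poly K x p \<longleftrightarrow>
     Polynomial.lead_coeff p = 1 \<and> F2_eval K p x = \<zero>\<^bsub>K\<^esub> \<and>
     (\<forall>q. q \<noteq> 0 \<and> F2_eval K q x = \<zero>\<^bsub>K\<^esub> \<longrightarrow> Polynomial.degree p \<le> Polynomial.degree q)"

text \<open>The primes are numbered from one: \<open>nth_prime 1 = 2\<close>.\<close>

definition nth_prime :: "nat \<Rightarrow> nat" where
  "nth_prime i = enumerate {p :: nat. Factorial_Ring.prime p} (i - 1)"


section \<open>The lamplighter group and its congruence subgroups\<close>

text \<open>
  With the convolution product, finitely supported functions from the integers to \<open>F\<^sub>2\<close> are the
  Laurent polynomials; \<open>Poly_Mapping.single n c\<close> is the monomial with exponent \<open>n\<close> and
  coefficient \<open>c\<close>.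
\<close>

type_synonym laurent = "int \<Rightarrow>\<^sub>0 bit"

abbreviation laurent_ring :: "laurent ring" where
  "laurent_ring \<equiv> ring_of_type_algebra"

definition laurent_of_poly :: "bit poly \<Rightarrow> laurent" where
  "laurent_of_poly p =
     (\<Sum>i\<le>Polynomial.degree p. Poly_Mapping.single (int i) (Polynomial.coeff p i))"

definition lamplighter :: "(laurent ^ 2 ^ 2) monoid" where
  "lamplighter = (GL2 laurent_ring)
     \<lparr>carrier := {vector [vector [Poly_Mapping.single n 1, P], vector [0, 1]] | n P. True}\<rparr>"

definition I_ideal :: "(nat \<Rightarrow> bit poly) \<Rightarrow> nat \<Rightarrow> laurent set" where
  "I_ideal P k = Idl\<^bsub>laurent_ring\<^esub> {\<Prod>i=1..k. laurent_of_poly (P i)}"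

definition N_subgroup :: "(nat \<Rightarrow> bit poly) \<Rightarrow> nat \<Rightarrow> (laurent ^ 2 ^ 2) set" where
  "N_subgroup P k =
     carrier lamplighter \<inter>
     kernel (GL2 laurent_ring) (GL2 (laurent_ring Quot I_ideal P k))
       (mat2_mod laurent_ring (I_ideal P k))"

end

theory Submission
  imports Defs "HOL-Number_Theory.Pocklington"
begin

text \<open>
  Write \<open>Q\<^sub>k = P\<^sub>1 \<cdots> P\<^sub>k\<close> and \<open>M\<^sub>k = (2 ^ p\<^sub>1 - 1) \<cdots> (2 ^ p\<^sub>k - 1)\<close>. The numbers \<open>2 ^ p\<^sub>i - 1\<close> are
  pairwise coprime, so the \<open>P\<^sub>i\<close> are pairwise non-associated primes and \<open>X ^ n = 1\<close> modulo \<open>Q\<^sub>k\<close> if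
  and only if \<open>M\<^sub>k\<close> divides \<open>n\<close>. Hence \<open>G/N\<^sub>k\<close> has at most \<open>M\<^sub>k 2 ^ (p\<^sub>1 + \<cdots> + p\<^sub>k) \<le> 2 M\<^sub>k ^ 2\<close>
  elements, because \<open>\<Prod>(1 - 2 ^ (-p\<^sub>i)) \<ge> 1/2\<close>. On the other hand \<open>G/N\<^sub>k\<close> maps onto the cyclic group of
  order \<open>M\<^sub>k\<close> by the exponent of \<open>X\<close>, and the exponents of the generators are bounded, so the
  diameter is at least a constant times \<open>M\<^sub>k\<close>.
\<close>

section \<open>Products of Mersenne numbers\<close>

lemma nth_prime_prime: "Factorial_Ring.prime (nth_prime i)"
  unfolding nth_prime_def using enumerate_in_set[OF primes_infinite] by auto

text \<open>The enumeration of the primes starts at 2 and is strictly increasing. This crude bound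
  is enough for all later estimates.\<close>

lemma nth_prime_ge: "i \<ge> 1 \<Longrightarrow> i + 1 \<le> nth_prime i"
proof -
  have "n + 2 \<le> enumerate {p :: nat. Factorial_Ring.prime p} n" for n
  proof (induction n)
    case 0
    have "Factorial_Ring.prime (enumerate {p :: nat. Factorial_Ring.prime p} 0)"
      using enumerate_in_set[OF primes_infinite] by auto
    then show ?case using prime_ge_2_nat[of "enumerate {p. Factorial_Ring.prime p} 0"] by simp
  next
    case (Suc n)
    then show ?case using enumerate_step[OF primes_infinite, of n] by linarith
  qed
  from this[of "i - 1"] show "i \<ge> 1 \<Longrightarrow> i + 1 \<le> nth_prime i"
    by (simp add: nth_prime_def)
qed

lemma nth_prime_inject: "i \<ge> 1 \<Longrightarrow> j \<ge> 1 \<Longrightarrow> nth_prime i = nth_prime j \<longleftrightarrow> i = j"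
  unfolding nth_prime_def
  using strict_mono_eq[OF strict_mono_enumerate[OF primes_infinite]]
  by (metis Suc_diff_1 less_eq_Suc_le One_nat_def)

text \<open>The order of 2 modulo a common divisor \<open>r\<close> divides both primes, hence
  divides 1, so \<open>r\<close> divides 2 - 1.\<close>

lemma coprime_mersenne:
  assumes "Factorial_Ring.prime p" "Factorial_Ring.prime q" "p \<noteq> q"
  shows "coprime (2 ^ p - 1 :: nat) (2 ^ q - 1)"
proof (rule coprimeI)
  fix r :: nat
  assume r: "r dvd 2 ^ p - 1" "r dvd 2 ^ q - 1"
  have *: "ord r 2 dvd n" if "r dvd 2 ^ n - 1" for n
  proof -
    have "[2 ^ n = 1] (mod r)"
      using that cong_altdef_nat[of 1 "2 ^ n" r] by simp
    then show ?thesis by (simp only: ord_divides)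
  qed
  have "coprime p q" by (rule primes_coprime[OF assms])
  then have "ord r 2 dvd 1" using *[OF r(1)] *[OF r(2)] by (rule coprime_common_divisor)
  then have "[2 ^ 1 = 1] (mod r)" using ord_divides[of 2 1 r] by blast
  then show "is_unit r" using cong_altdef_nat[of 1 2 r] by simp
qed

definition mersenne_prod :: "nat \<Rightarrow> nat" where
  "mersenne_prod k = (\<Prod>i=1..k. 2 ^ nth_prime i - 1)"

lemma mersenne_prod_pos: "mersenne_prod k > 0"
  unfolding mersenne_prod_def
proof (intro prod_pos ballI)
  fix i
  have "(1::nat) < 2 ^ nth_prime i"
    by (rule one_less_power) (simp_all add: prime_gt_0_nat[OF nth_prime_prime])
  then show "0 < (2::nat) ^ nth_prime i - 1" by simp
qed

text \<open>Distinct indices give distinct primes, so the factors are pairwise coprime and can be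
  absorbed one at a time.\<close>

lemma mersenne_prod_dvd_iff:
  "mersenne_prod k dvd n \<longleftrightarrow> (\<forall>i\<in>{1..k}. 2 ^ nth_prime i - 1 dvd n)"
proof
  assume "mersenne_prod k dvd n"
  then show "\<forall>i\<in>{1..k}. 2 ^ nth_prime i - 1 dvd n"
    unfolding mersenne_prod_def using dvd_prodI[of "{1..k}"] by (meson dvd_trans finite_atLeastAtMost)
next
  assume "\<forall>i\<in>{1..k}. 2 ^ nth_prime i - 1 dvd n"
  then show "mersenne_prod k dvd n"
  proof (induction k)
    case (Suc k)
    have "coprime (mersenne_prod k) (2 ^ nth_prime (Suc k) - 1)"
      unfolding mersenne_prod_def
      by (intro prod_coprime_left coprime_mersenne nth_prime_prime) (auto simp: nth_prime_inject)
    moreover have "mersenne_prod (Suc k) = mersenne_prod k * (2 ^ nth_prime (Suc k) - 1)"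
      by (simp add: mersenne_prod_def)
    ultimately show ?case using Suc by (simp add: divides_mult)
  qed (simp add: mersenne_prod_def)
qed

text \<open>Weierstrass' product inequality for \<open>\<Prod>(1 - 2 ^ (-p\<^sub>i))\<close>, using only \<open>p\<^sub>i \<ge> i + 1\<close>.\<close>
lemma power_sum_nth_prime_le: "2 ^ (\<Sum>i=1..k. nth_prime i) \<le> 2 * mersenne_prod k"
proof -
  \<comment> \<open>The constant 1/2 alone is not preserved by the induction. The strengthened one
    equals 1 minus the sum of 2^-(i+1) over i from 1 to k, which reflects the bound p_i \<ge> i +
    1.\<close>
  have "(1/2 + 1 / 2 ^ (k+1)) * 2 ^ (\<Sum>i=1..k. nth_prime i) \<le> real (mersenne_prod k)"
  proof (induction k)
    case 0
    show ?case by (simp add: mersenne_prod_def)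
  next
    case (Suc k)
    define p where "p = nth_prime (Suc k)"
    define A :: real where "A = 2 ^ (\<Sum>i=1..k. nth_prime i)"
    have A: "A > 0" by (simp add: A_def)
    have p: "(2::real) ^ (k + 2) \<le> 2 ^ p"
      using nth_prime_ge[of "Suc k"] by (intro power_increasing) (auto simp: p_def)
    define x :: real where "x = 2 ^ k"
    have x: "x \<ge> 1" by (simp add: x_def)
    define y :: real where "y = 2 ^ p"
    have y: "y \<ge> 4 * x" using p by (simp add: x_def y_def)
    \<comment> \<open>Up to a positive factor, clearing denominators leaves
      \<open>2*x + 2 \<le> y\<close>, a consequence of \<open>y \<ge> 4*x\<close> and
      \<open>x \<ge> 1\<close>.\<close>
    have main: "(1/2 + 1 / (4*x)) * y \<le> (1/2 + 1/(2*x)) * (y - 1)"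
    proof -
      have "1 * x \<le> x * x" using x by (intro mult_right_mono) auto
      moreover have "x * (4 * x) \<le> x * y" using x y by (intro mult_left_mono) auto
      ultimately have "x * 4 + x * (x * 4) \<le> x * (y * 2)" by (simp add: algebra_simps)
      then show ?thesis using x by (simp add: field_simps)
    qed
    have M: "real (mersenne_prod (Suc k)) = real (mersenne_prod k) * (y - 1)"
      by (simp add: mersenne_prod_def y_def p_def of_nat_diff)
    have "(1/2 + 1 / 2 ^ (Suc k+1)) * 2 ^ (\<Sum>i=1..Suc k. nth_prime i) = A * ((1/2 + 1 / (4*x)) * y)"
      by (simp add: A_def x_def y_def p_def power_add)
    also have "\<dots> \<le> A * ((1/2 + 1/(2*x)) * (y - 1))"
      using A main by (intro mult_left_mono) auto
    also have "\<dots> = ((1/2 + 1 / 2 ^ (k+1)) * A) * (y - 1)"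
      by (simp add: x_def)
    also have "\<dots> \<le> real (mersenne_prod k) * (y - 1)"
      using Suc.IH x y by (intro mult_right_mono) (auto simp: A_def)
    finally show ?case by (simp only: M)
  qed
  moreover have "1/2 * 2 ^ (\<Sum>i=1..k. nth_prime i) \<le> (1/2 + 1 / 2 ^ (k+1)) * (2::real) ^ (\<Sum>i=1..k. nth_prime i)"
    by (intro mult_right_mono) auto
  ultimately have "1/2 * 2 ^ (\<Sum>i=1..k. nth_prime i) \<le> real (mersenne_prod k)" by linarith
  then have "real (2 ^ (\<Sum>i=1..k. nth_prime i)) \<le> real (2 * mersenne_prod k)" by simp
  then show ?thesis by (simp only: of_nat_le_iff)
qed

text \<open>Every factor is at least 3. The growth kills the exponents in the intersection of the
  congruence subgroups, and it excludes a trivial cyclic quotient in the diameter estimate.\<close>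

lemma mersenne_prod_ge: "k > 0 \<Longrightarrow> 2 ^ k < mersenne_prod k"
proof (induction k rule: nat_induct_non_zero)
  case 1
  have "(2::nat) ^ 2 \<le> 2 ^ nth_prime 1"
    using nth_prime_ge[of 1] by (intro power_increasing) auto
  then show ?case by (simp add: mersenne_prod_def)
next
  case (Suc k)
  have "(2::nat) ^ 2 \<le> 2 ^ nth_prime (Suc k)"
    using nth_prime_ge[of "Suc k"] by (intro power_increasing) auto
  then have "2 \<le> 2 ^ nth_prime (Suc k) - (1::nat)" by simp
  then have "2 ^ k * 2 < mersenne_prod k * (2 ^ nth_prime (Suc k) - 1)"
    using Suc.IH by (intro mult_less_le_imp_less) auto
  then show ?case by (simp add: mersenne_prod_def mult.commute)
qed


section \<open>Minimal polynomials over the field with two elements\<close>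

text \<open>The condition on coefficients stands for "degree below \<open>n\<close>" in a form that
  keeps the zero polynomial when \<open>n = 0\<close>. Such polynomials correspond to bit lists of
  length \<open>n\<close>.\<close>

lemma card_bit_polys_degree_less: "card {p :: bit poly. \<forall>i\<ge>n. Polynomial.coeff p i = 0} = 2 ^ n"
proof -
  have "bij_betw Poly {xs :: bit list. length xs = n} {p. \<forall>i\<ge>n. Polynomial.coeff p i = 0}"
  proof (rule bij_betw_imageI)
    show "inj_on Poly {xs :: bit list. length xs = n}"
    proof (rule inj_onI)
      fix xs ys :: "bit list"
      assume *: "xs \<in> {xs. length xs = n}" "ys \<in> {xs. length xs = n}" "Poly xs = Poly ys"
      have "nth_default 0 xs i = nth_default 0 ys i" for i
        using arg_cong[OF *(3), of "\<lambda>p. Polynomial.coeff p i"] by (simp add: coeff_Poly_eq)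
      then have "xs ! i = ys ! i" if "i < n" for i
        using *(1,2) that by (metis (mono_tags) mem_Collect_eq nth_default_nth)
      then show "xs = ys" using *(1,2) by (intro nth_equalityI) auto
    qed
    show "Poly ` {xs :: bit list. length xs = n} = {p. \<forall>i\<ge>n. Polynomial.coeff p i = 0}"
    proof (intro equalityI subsetI)
      fix p :: "bit poly"
      assume "p \<in> {p. \<forall>i\<ge>n. Polynomial.coeff p i = 0}"
      then have "p = Poly (map (Polynomial.coeff p) [0..<n])"
        by (intro poly_eqI) (auto simp: coeff_Poly_eq nth_default_def)
      then show "p \<in> Poly ` {xs. length xs = n}" by (rule image_eqI) simp
    qed (auto simp: coeff_Poly_eq nth_default_def)
  qed
  then have "card {p :: bit poly. \<forall>i\<ge>n. Polynomial.coeff p i = 0} = card {xs :: bit list. length xs = n}"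
    by (rule bij_betw_same_card[symmetric])
  also have "\<dots> = card {xs. set xs \<subseteq> {0, 1 :: bit} \<and> length xs = n}"
    using bit.exhaust by (intro arg_cong[where f = card]) blast
  also have "\<dots> = 2 ^ n" by (simp add: card_lists_length_eq numeral_2_eq_2)
  finally show ?thesis .
qed

text \<open>The extra axiom makes \<open>F2_embed R\<close> additive, so that evaluation at a point
  becomes a ring homomorphism.\<close>

locale F2_algebra = cring R for R (structure) +
  assumes one_plus_one: "\<one> \<oplus> \<one> = \<zero>"
begin

lemma F2_embed_closed [simp]: "F2_embed R c \<in> carrier R"
  by (simp add: F2_embed_def)

lemma F2_embed_add: "F2_embed R (a + b) = F2_embed R a \<oplus> F2_embed R b"
  by (cases a; cases b) (auto simp: F2_embed_def one_plus_one)

context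
  fixes x assumes x: "x \<in> carrier R"
begin

lemma F2_eval_closed [simp]: "F2_eval R p x \<in> carrier R"
  unfolding F2_eval_def using x by (intro finsum_closed) auto

lemma F2_eval_0 [simp]: "F2_eval R 0 x = \<zero>"
  by (simp add: F2_eval_def F2_embed_def)

text \<open>Horner's rule: it removes the degree from the sum, so additivity and multiplicativity
  follow by induction. The case \<open>p = 0\<close> is separate because there \<open>pCons\<close>
  does not raise the degree.\<close>

lemma F2_eval_pCons: "F2_eval R (pCons a p) x = F2_embed R a \<oplus> x \<otimes> F2_eval R p x"
proof (cases "p = 0")
  case True
  then show ?thesis using x by (simp add: F2_eval_def F2_embed_def)
next
  case False
  have "F2_eval R (pCons a p) x =
      (\<Oplus>i\<in>{..Suc (Polynomial.degree p)}. F2_embed R (Polynomial.coeff (pCons a p) i) \<otimes> x [^] i)"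
    using False by (simp add: F2_eval_def)
  also have "\<dots> = (\<Oplus>i\<in>{..Polynomial.degree p}. F2_embed R (Polynomial.coeff p i) \<otimes> x [^] Suc i)
      \<oplus> F2_embed R a"
    using x by (subst finsum_Suc2) auto
  also have "(\<Oplus>i\<in>{..Polynomial.degree p}. F2_embed R (Polynomial.coeff p i) \<otimes> x [^] Suc i) =
      (\<Oplus>i\<in>{..Polynomial.degree p}. x \<otimes> (F2_embed R (Polynomial.coeff p i) \<otimes> x [^] i))"
    using x by (intro finsum_cong) (auto simp: m_ac simp_implies_def)
  also have "\<dots> = x \<otimes> F2_eval R p x"
    unfolding F2_eval_def using x by (intro finsum_rdistr[symmetric]) auto
  finally show ?thesis using x by (simp add: a_comm)
qed

lemma F2_eval_add: "F2_eval R (p + q) x = F2_eval R p x \<oplus> F2_eval R q x"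
proof (induction p q rule: poly_induct2)
  case (pCons a p b q)
  have "F2_eval R (pCons a p + pCons b q) x = F2_embed R (a + b) \<oplus> x \<otimes> F2_eval R (p + q) x"
    by (simp only: add_pCons F2_eval_pCons)
  also have "\<dots> = (F2_embed R a \<oplus> F2_embed R b) \<oplus> x \<otimes> (F2_eval R p x \<oplus> F2_eval R q x)"
    by (simp only: F2_embed_add pCons)
  finally show ?case using x by (simp add: F2_eval_pCons r_distr a_ac)
qed auto

lemma F2_eval_smult: "F2_eval R (Polynomial.smult a p) x = F2_embed R a \<otimes> F2_eval R p x"
  by (cases a) (simp_all add: F2_embed_def)

lemma F2_eval_mult: "F2_eval R (p * q) x = F2_eval R p x \<otimes> F2_eval R q x"
proof (induction p)
  case (pCons a p)
  then show ?case using x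
    by (simp add: mult_pCons_left F2_eval_add F2_eval_smult F2_eval_pCons F2_embed_def[of _ 0]
        l_distr m_assoc)
qed auto

lemma F2_eval_1: "F2_eval R 1 x = \<one>"
  using x by (simp add: one_pCons F2_eval_pCons F2_embed_def)

lemma F2_eval_monom: "F2_eval R (Polynomial.monom 1 n) x = x [^] n"
  using x by (induction n) (auto simp: monom_Suc F2_eval_pCons F2_embed_def F2_eval_1 m_comm)

lemma F2_eval_monom_minus_1:
  "F2_eval R (Polynomial.monom 1 n - 1) x = \<zero> \<longleftrightarrow> x [^] n = \<one>"
proof -
  \<comment> \<open>Adding 1 back turns the difference into a sum, to which additivity
    applies.\<close>
  have "F2_eval R (Polynomial.monom 1 n - 1 + 1) x = x [^] n"
    by (simp add: F2_eval_monom)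
  then have *: "F2_eval R (Polynomial.monom 1 n - 1) x \<oplus> \<one> = x [^] n"
    by (simp only: F2_eval_add F2_eval_1)
  then show ?thesis
    using x add.r_cancel_one'[of \<one> "F2_eval R (Polynomial.monom 1 n - 1) x"] by auto
qed

text \<open>Division with remainder: the remainder of \<open>f\<close> also vanishes at
  \<open>x\<close>, and by minimality of the degree it is zero.\<close>

lemma F2_eval_minimal_poly_eq_0_iff:
  assumes "is_minimal_poly R x P"
  shows "F2_eval R f x = \<zero> \<longleftrightarrow> P dvd f"
proof
  have P: "P \<noteq> 0" "F2_eval R P x = \<zero>"
    and min: "\<And>q. q \<noteq> 0 \<Longrightarrow> F2_eval R q x = \<zero> \<Longrightarrow> Polynomial.degree P \<le> Polynomial.degree q"
    using assms by (auto simp: is_minimal_poly_def)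
  {
    assume f: "F2_eval R f x = \<zero>"
    have "F2_eval R (P * (f div P) + f mod P) x = \<zero>" using f by simp
    then have "F2_eval R (f mod P) x = \<zero>"
      by (simp only: F2_eval_add F2_eval_mult P) simp
    then have "f mod P = 0"
      using min[of "f mod P"] degree_mod_less[OF P(1), of f] by fastforce
    then show "P dvd f" by (simp add: mod_eq_0_iff_dvd)
  next
    assume "P dvd f"
    then show "F2_eval R f x = \<zero>" by (auto simp: F2_eval_mult P elim!: dvdE)
  }
qed

end

end

text \<open>The additive group has order \<open>2 ^ n\<close>, so 2^n times the unit vanishes. This
  multiple is the \<open>n\<close>-th power of 1 + 1, and a field has no nonzero nilpotents.\<close>

lemma (in field) one_plus_one_eq_zero:
  assumes "card (carrier R) = 2 ^ n"
  shows "\<one> \<oplus> \<one> = \<zero>"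
proof -
  have *: "[(2 ^ k :: nat)] \<cdot> \<one> = (\<one> \<oplus> \<one>) [^] k" for k :: nat
  proof (induction k)
    case (Suc k)
    have "[(2 ^ Suc k :: nat)] \<cdot> \<one> = [(2 ^ k :: nat)] \<cdot> \<one> \<oplus> [(2 ^ k :: nat)] \<cdot> \<one>"
      by (simp add: mult_2 add.nat_pow_mult)
    then show ?case by (simp add: Suc r_distr)
  qed simp
  have "[(2 ^ n :: nat)] \<cdot> \<one> = \<zero>"
    using add.pow_order_eq_1[of \<one>] assms by (simp add: order_def add_pow_def)
  then have "(\<one> \<oplus> \<one>) [^] n = \<zero>" by (simp add: *)
  moreover have "(\<one> \<oplus> \<one>) [^] k = \<zero> \<Longrightarrow> \<one> \<oplus> \<one> = \<zero>" for k :: nat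
    by (induction k) (auto dest: integral)
  ultimately show ?thesis by blast
qed

lemma F2_algebra_of_field:
  assumes "field K" "card (carrier K) = 2 ^ n"
  shows "F2_algebra K"
proof -
  interpret field K by fact
  show ?thesis by unfold_locales (rule one_plus_one_eq_zero[OF assms(2)])
qed

text \<open>\<open>P\<close> generates the kernel of a homomorphism into a field, and such a kernel
  is a prime ideal.\<close>

lemma prime_elem_minimal_poly:
  assumes "field K" "card (carrier K) = 2 ^ n" "x \<in> carrier K" "is_minimal_poly K x P"
  shows "prime_elem P"
proof -
  interpret field K by fact
  interpret F2_algebra K by (rule F2_algebra_of_field[OF assms(1,2)])
  show ?thesis
  proof (rule prime_elemI)
    show "P \<noteq> 0" using assms(4) by (auto simp: is_minimal_poly_def)
    show "\<not> P dvd 1"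
      using F2_eval_1[OF assms(3)] F2_eval_minimal_poly_eq_0_iff[OF assms(3,4), of 1] by auto
    show "P dvd a \<or> P dvd b" if "P dvd a * b" for a b
      using that assms(3) F2_eval_minimal_poly_eq_0_iff[OF assms(3,4)]
      by (metis F2_eval_closed F2_eval_mult integral)
  qed
qed

text \<open>Distinct polynomials of degree below that of \<open>P\<close> take distinct values at
  \<open>x\<close>, since \<open>P\<close> cannot divide their difference. Counting them against the
  elements of \<open>K\<close> gives the bound.\<close>

lemma degree_minimal_poly_le:
  assumes "field K" "card (carrier K) = 2 ^ n" "x \<in> carrier K" "is_minimal_poly K x P"
  shows "Polynomial.degree P \<le> n"
proof -
  interpret field K by fact
  interpret F2_algebra K by (rule F2_algebra_of_field[OF assms(1,2)])
  define A where "A = {p :: bit poly. \<forall>i\<ge>Polynomial.degree P. Polynomial.coeff p i = 0}"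
  have fin: "finite (carrier K)" by (rule card_ge_0_finite) (simp add: assms)
  have "inj_on (\<lambda>p. F2_eval K p x) A"
  proof (rule inj_onI)
    fix p q assume pq: "p \<in> A" "q \<in> A" "F2_eval K p x = F2_eval K q x"
    have "F2_eval K (p - q + q) x = F2_eval K (p - q) x \<oplus>\<^bsub>K\<^esub> F2_eval K q x"
      by (rule F2_eval_add[OF assms(3)])
    then have "F2_eval K (p - q) x = \<zero>\<^bsub>K\<^esub>"
      using assms(3) pq(3) by (simp add: F2_eval_closed)
    then have "P dvd p - q" using F2_eval_minimal_poly_eq_0_iff[OF assms(3,4)] by simp
    moreover have False if "p - q \<noteq> 0" "P dvd p - q"
    proof -
      have "Polynomial.degree P \<le> Polynomial.degree (p - q)" using that by (rule dvd_imp_degree_le[rotated])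
      then have "Polynomial.lead_coeff (p - q) = 0"
        using pq(1,2) by (auto simp: A_def)
      then show False using that(1) by (simp only: leading_coeff_0_iff)
    qed
    ultimately show "p = q" by force
  qed
  then have "card A \<le> card (carrier K)"
    using assms(3) fin by (intro card_inj_on_le) (auto simp: F2_eval_closed)
  then have "(2::nat) ^ Polynomial.degree P \<le> 2 ^ n"
    unfolding A_def card_bit_polys_degree_less assms(2) .
  then show ?thesis by simp
qed

lemma pow_generator_eq_1_iff:
  fixes n :: nat
  assumes "field K" "card (carrier K) = 2 ^ p" "x \<in> carrier (Multiplicative_Group.mult_of K)"
    "generate (Multiplicative_Group.mult_of K) {x} = carrier (Multiplicative_Group.mult_of K)"
  shows "x [^]\<^bsub>K\<^esub> n = \<one>\<^bsub>K\<^esub> \<longleftrightarrow> 2 ^ p - 1 dvd n"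
proof -
  interpret field K by fact
  interpret M: group "Multiplicative_Group.mult_of K" by (rule field_mult_group)
  have fin: "finite (carrier K)" by (rule card_ge_0_finite) (simp add: assms)
  have "M.ord x = 2 ^ p - 1"
    using M.generate_pow_card[OF assms(3)] assms(2,4) order_mult_of[OF fin]
    by (simp add: order_def)
  then show ?thesis
    using M.pow_eq_id[OF assms(3), of n] by (simp add: Multiplicative_Group.nat_pow_mult_of)
qed


section \<open>Divisibility of Laurent polynomials\<close>

lemma lookup_laurent_of_poly:
  "Poly_Mapping.lookup (laurent_of_poly p) j = (if j \<ge> 0 then Polynomial.coeff p (nat j) else 0)"
proof -
  have "Poly_Mapping.lookup (laurent_of_poly p) j =
      (\<Sum>i\<le>Polynomial.degree p. if i = nat j \<and> j \<ge> 0 then Polynomial.coeff p i else 0)"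
    unfolding laurent_of_poly_def lookup_sum lookup_single
    by (intro sum.cong) (auto simp: when_def)
  also have "\<dots> = (if j \<ge> 0 then Polynomial.coeff p (nat j) else 0)"
    by (auto simp: coeff_eq_0 not_le)
  finally show ?thesis .
qed

lemma laurent_of_poly_eq_iff: "laurent_of_poly p = laurent_of_poly q \<longleftrightarrow> p = q"
proof
  assume eq: "laurent_of_poly p = laurent_of_poly q"
  show "p = q"
  proof (rule poly_eqI)
    fix n
    show "Polynomial.coeff p n = Polynomial.coeff q n"
      using arg_cong[OF eq, of "\<lambda>f. Poly_Mapping.lookup f (int n)"]
      by (simp add: lookup_laurent_of_poly)
  qed
qed auto

lemma laurent_of_poly_add: "laurent_of_poly (p + q) = laurent_of_poly p + laurent_of_poly q"
  by (rule poly_mapping_eqI) (simp only: lookup_add lookup_laurent_of_poly coeff_add, auto)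

lemma laurent_of_poly_0 [simp]: "laurent_of_poly 0 = 0"
  by (simp add: laurent_of_poly_def)

lemma laurent_of_poly_pCons:
  "laurent_of_poly (pCons a p) = Poly_Mapping.single 0 a + Poly_Mapping.single 1 1 * laurent_of_poly p"
proof (cases "p = 0")
  case False
  have *: "Poly_Mapping.single 1 1 * Poly_Mapping.single (int i) c = Poly_Mapping.single (int (Suc i)) c"
    for i and c :: bit
    by (simp only: mult_single mult_1) simp
  have "Polynomial.degree (pCons a p) = Suc (Polynomial.degree p)" using False by simp
  then show ?thesis
    unfolding laurent_of_poly_def
    by (simp only: sum.atMost_Suc_shift sum_distrib_left * coeff_pCons_0 coeff_pCons_Suc of_nat_0)
qed (simp add: laurent_of_poly_def)

lemma laurent_of_poly_mult: "laurent_of_poly (p * q) = laurent_of_poly p * laurent_of_poly q"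
proof (induction p)
  case (pCons a p)
  have "laurent_of_poly (Polynomial.smult a q) = Poly_Mapping.single 0 a * laurent_of_poly q"
    by (cases a) simp_all
  then show ?case
    by (simp add: laurent_of_poly_add laurent_of_poly_pCons pCons algebra_simps)
qed simp

lemma laurent_of_poly_monom: "laurent_of_poly (Polynomial.monom 1 n) = Poly_Mapping.single (int n) 1"
proof (induction n)
  case 0
  show ?case by (simp add: monom_0 laurent_of_poly_pCons)
next
  case (Suc n)
  then show ?case by (simp add: monom_Suc laurent_of_poly_pCons mult_single)
qed

lemma laurent_of_poly_1 [simp]: "laurent_of_poly 1 = 1"
  using laurent_of_poly_monom[of 0] by simp

lemma laurent_of_poly_diff: "laurent_of_poly (p - q) = laurent_of_poly p - laurent_of_poly q"
  using laurent_of_poly_add[of "p - q" q] by (simp add: eq_diff_eq)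

lemma laurent_of_poly_prod: "laurent_of_poly (\<Prod>i\<in>A. f i) = (\<Prod>i\<in>A. laurent_of_poly (f i))"
  by (induction A rule: infinite_finite_induct) (auto simp: laurent_of_poly_mult)

lemma laurent_monomial_mult:
  "Poly_Mapping.single m 1 * Poly_Mapping.single n 1 = (Poly_Mapping.single (m + n) 1 :: laurent)"
  by (simp add: mult_single)

lemma laurent_monomial_inverse:
  "Poly_Mapping.single m 1 * Poly_Mapping.single (- m) 1 = (1 :: laurent)"
  "Poly_Mapping.single (- m) 1 * Poly_Mapping.single m 1 = (1 :: laurent)"
  by (simp_all add: mult_single)

text \<open>The support is finite, so a high power of X clears all negative exponents. As X is a
  unit, questions about Laurent polynomials reduce to ordinary ones.\<close>

lemma ex_laurent_of_poly:
  "\<exists>n p. Poly_Mapping.single (int n) 1 * f = laurent_of_poly p" for f :: laurent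
proof (induction f rule: update_induct)
  case const
  have "Poly_Mapping.single (int 0) 1 * 0 = laurent_of_poly 0" by simp
  then show ?case by blast
next
  case (update f a b)
  then obtain n p where np: "Poly_Mapping.single (int n) 1 * f = laurent_of_poly p" by blast
  have upd: "Poly_Mapping.update a b f = f + Poly_Mapping.single a b"
    using update(1) by (intro poly_mapping_eqI)
      (auto simp: lookup_update lookup_add lookup_single when_def in_keys_iff)
  \<comment> \<open>X^m clears the new term and X^n the old ones, so X^(n+m) clears both.\<close>
  define m where "m = nat \<bar>a\<bar>"
  have m: "int m + a \<ge> 0" by (simp add: m_def)
  have "Poly_Mapping.single (int m) 1 * Poly_Mapping.single a b =
      laurent_of_poly (Polynomial.smult b (Polynomial.monom 1 (nat (int m + a))))"
    by (cases b) (simp_all add: mult_single laurent_of_poly_monom m)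
  then obtain q where q: "Poly_Mapping.single (int m) 1 * Poly_Mapping.single a b = laurent_of_poly q"
    by blast
  have s: "Poly_Mapping.single (int (n + m)) 1 =
      (Poly_Mapping.single (int m) 1 * Poly_Mapping.single (int n) 1 :: laurent)"
    by (simp add: laurent_monomial_mult add.commute)
  have "Poly_Mapping.single (int (n + m)) 1 * Poly_Mapping.update a b f =
      Poly_Mapping.single (int m) 1 * (Poly_Mapping.single (int n) 1 * f) +
      Poly_Mapping.single (int n) 1 * (Poly_Mapping.single (int m) 1 * Poly_Mapping.single a b)"
    unfolding upd s by (simp only: distrib_left mult_ac)
  also have "\<dots> = laurent_of_poly (Polynomial.monom 1 m * p + Polynomial.monom 1 n * q)"
    unfolding np q by (simp only: laurent_of_poly_add laurent_of_poly_mult laurent_of_poly_monom)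
  finally show ?case by blast
qed

text \<open>The Laurent polynomials are the localisation at X. The assumption says that powers of X
  cancel modulo \<open>Q\<close>, so inverting X creates no new divisibility by
  \<open>Q\<close>.\<close>

lemma laurent_dvd_iff:
  assumes "\<And>n h. Q dvd Polynomial.monom 1 n * h \<Longrightarrow> Q dvd h"
  shows "laurent_of_poly Q dvd laurent_of_poly g \<longleftrightarrow> Q dvd g"
proof
  assume "laurent_of_poly Q dvd laurent_of_poly g"
  then obtain h where h: "laurent_of_poly g = laurent_of_poly Q * h" by (elim dvdE)
  obtain n p where np: "Poly_Mapping.single (int n) 1 * h = laurent_of_poly p"
    using ex_laurent_of_poly by blast
  have "laurent_of_poly (Polynomial.monom 1 n * g) =
      laurent_of_poly Q * (Poly_Mapping.single (int n) 1 * h)"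
    by (simp only: laurent_of_poly_mult laurent_of_poly_monom h mult_ac)
  also have "\<dots> = laurent_of_poly (Q * p)" by (simp only: laurent_of_poly_mult np)
  finally have "Q dvd Polynomial.monom 1 n * g" by (simp only: laurent_of_poly_eq_iff dvd_triv_left)
  then show "Q dvd g" by (rule assms)
qed (auto simp: laurent_of_poly_mult)

lemma laurent_dvd_monomial_mult_iff:
  "f dvd Poly_Mapping.single n 1 * g \<longleftrightarrow> f dvd g" for f g :: laurent
proof
  assume "f dvd Poly_Mapping.single n 1 * g"
  then have "f dvd Poly_Mapping.single (- n) 1 * (Poly_Mapping.single n 1 * g)" by (rule dvd_mult)
  then show "f dvd g" by (simp only: mult.assoc[symmetric] laurent_monomial_inverse mult_1)
qed simp

section \<open>Arithmetic of the minimal polynomials and their products\<close>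

locale congruence_polys =
  fixes K :: "nat \<Rightarrow> ('a, 'b) ring_scheme" and \<alpha> :: "nat \<Rightarrow> 'a" and P :: "nat \<Rightarrow> bit poly"
  assumes field_K: "i \<ge> 1 \<Longrightarrow> field (K i)"
    and card_K: "i \<ge> 1 \<Longrightarrow> card (carrier (K i)) = 2 ^ nth_prime i"
    and \<alpha>: "i \<ge> 1 \<Longrightarrow> \<alpha> i \<in> carrier (Multiplicative_Group.mult_of (K i))"
    and generator: "i \<ge> 1 \<Longrightarrow>
      generate (Multiplicative_Group.mult_of (K i)) {\<alpha> i} = carrier (Multiplicative_Group.mult_of (K i))"
    and minimal: "i \<ge> 1 \<Longrightarrow> is_minimal_poly (K i) (\<alpha> i) (P i)"
begin

definition Q :: "nat \<Rightarrow> bit poly" where "Q k = (\<Prod>i=1..k. P i)"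

lemma \<alpha>_carrier: "i \<ge> 1 \<Longrightarrow> \<alpha> i \<in> carrier (K i)"
  using \<alpha> by auto

lemma prime_elem_P: "i \<ge> 1 \<Longrightarrow> prime_elem (P i)"
  using prime_elem_minimal_poly[OF field_K card_K \<alpha>_carrier minimal] .

text \<open>\<open>P i\<close> divides exactly the polynomials vanishing at
  \<open>\<alpha> i\<close>, whose multiplicative order is
  \<open>2 ^ nth_prime i - 1\<close>.\<close>

lemma P_dvd_monom_minus_1_iff:
  assumes "i \<ge> 1"
  shows "P i dvd Polynomial.monom 1 n - 1 \<longleftrightarrow> 2 ^ nth_prime i - 1 dvd n"
proof -
  interpret F2_algebra "K i" by (rule F2_algebra_of_field[OF field_K[OF assms] card_K[OF assms]])
  show ?thesis
    using F2_eval_minimal_poly_eq_0_iff[OF \<alpha>_carrier[OF assms] minimal[OF assms], symmetric]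
      F2_eval_monom_minus_1[OF \<alpha>_carrier[OF assms]]
      pow_generator_eq_1_iff[OF field_K[OF assms] card_K[OF assms] \<alpha>[OF assms] generator[OF assms]]
    by simp
qed

text \<open>Otherwise \<open>P i\<close> would divide X^n - 1 with n = 2^(p_j) - 1, and one Mersenne
  number would divide another that is coprime to it. It would then be 1, yet it is at least
  3.\<close>

lemma not_P_dvd_P:
  assumes "i \<ge> 1" "j \<ge> 1" "i \<noteq> j"
  shows "\<not> P i dvd P j"
proof
  assume "P i dvd P j"
  moreover have "P j dvd Polynomial.monom 1 (2 ^ nth_prime j - 1) - 1"
    using P_dvd_monom_minus_1_iff[OF assms(2)] by simp
  ultimately have "2 ^ nth_prime i - 1 dvd (2 ^ nth_prime j - 1 :: nat)"
    using P_dvd_monom_minus_1_iff[OF assms(1)] dvd_trans by blast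
  moreover have "coprime (2 ^ nth_prime i - 1 :: nat) (2 ^ nth_prime j - 1)"
    using assms by (intro coprime_mersenne nth_prime_prime) (simp add: nth_prime_inject)
  ultimately have "2 ^ nth_prime i - (1::nat) = 1"
    using coprime_common_divisor dvd_refl nat_dvd_1_iff_1 by blast
  moreover have "(2::nat) ^ 2 \<le> 2 ^ nth_prime i"
    using nth_prime_ge[OF assms(1)] assms(1) by (intro power_increasing) auto
  ultimately show False by simp
qed

text \<open>A generator \<open>\<alpha> i\<close> is nonzero, and so are its powers.\<close>

lemma not_P_dvd_monom: "i \<ge> 1 \<Longrightarrow> \<not> P i dvd Polynomial.monom 1 n"
proof
  assume i: "i \<ge> 1" and dvd: "P i dvd Polynomial.monom 1 n"
  interpret field "K i" by (rule field_K[OF i])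
  interpret F2_algebra "K i" by (rule F2_algebra_of_field[OF field_K[OF i] card_K[OF i]])
  have "\<alpha> i [^]\<^bsub>K i\<^esub> n = \<zero>\<^bsub>K i\<^esub>"
    using dvd F2_eval_minimal_poly_eq_0_iff[OF \<alpha>_carrier[OF i] minimal[OF i], of "Polynomial.monom 1 n"]
    by (simp add: F2_eval_monom[OF \<alpha>_carrier[OF i]])
  moreover have "\<alpha> i [^]\<^bsub>K i\<^esub> m \<noteq> \<zero>\<^bsub>K i\<^esub>" for m :: nat
    using \<alpha>[OF i] by (induction m) (auto dest: integral)
  ultimately show False by blast
qed

text \<open>The \<open>P i\<close> are primes, none dividing another, so divisibility by each one
  yields divisibility by the product.\<close>

lemma Q_dvd_iff: "Q k dvd f \<longleftrightarrow> (\<forall>i\<in>{1..k}. P i dvd f)"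
proof
  assume "Q k dvd f"
  then show "\<forall>i\<in>{1..k}. P i dvd f"
    unfolding Q_def by (meson dvd_prodI dvd_trans finite_atLeastAtMost)
next
  assume "\<forall>i\<in>{1..k}. P i dvd f"
  then show "Q k dvd f"
  proof (induction k)
    case (Suc k)
    have prime: "prime_elem (P (Suc k))" by (rule prime_elem_P) simp
    \<comment> \<open>Arbitrary subsets of \<open>{1..k}\<close> make finite set induction
      applicable.\<close>
    have "\<not> P (Suc k) dvd (\<Prod>i\<in>A. P i)" if "A \<subseteq> {1..k}" for A
      using finite_subset[OF that finite_atLeastAtMost] that
    proof (induction A rule: finite_induct)
      case (insert x F)
      then show ?case
        using not_P_dvd_P[of "Suc k" x] prime by (auto simp: prime_elem_dvd_mult_iff)
    qed (simp add: prime_elem_not_unit[OF prime])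
    then have "\<not> P (Suc k) dvd Q k" by (simp add: Q_def)
    moreover obtain g where g: "f = Q k * g" using Suc by auto
    moreover have "P (Suc k) dvd f" using Suc.prems by simp
    ultimately have "P (Suc k) dvd g" using prime by (simp add: prime_elem_dvd_mult_iff)
    then show ?case by (auto simp: g Q_def)
  qed (simp add: Q_def)
qed

lemma Q_dvd_monom_multD: "Q k dvd Polynomial.monom 1 n * h \<Longrightarrow> Q k dvd h"
  using not_P_dvd_monom prime_elem_P by (auto simp: Q_dvd_iff prime_elem_dvd_mult_iff)

lemma laurent_Q_dvd_iff: "laurent_of_poly (Q k) dvd laurent_of_poly g \<longleftrightarrow> Q k dvd g"
  by (rule laurent_dvd_iff) (rule Q_dvd_monom_multD)

text \<open>X has order \<open>mersenne_prod k\<close> modulo \<open>Q k\<close>, by combining its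
  orders modulo the factors \<open>P i\<close>.\<close>

lemma laurent_Q_dvd_monomial_minus_1_iff:
  "laurent_of_poly (Q k) dvd Poly_Mapping.single n 1 - 1 \<longleftrightarrow> int (mersenne_prod k) dvd n"
proof -
  have *: "laurent_of_poly (Q k) dvd Poly_Mapping.single (int n) 1 - 1 \<longleftrightarrow> int (mersenne_prod k) dvd int n" for n
  proof -
    have "Poly_Mapping.single (int n) 1 - 1 = laurent_of_poly (Polynomial.monom 1 n - 1)"
      by (simp only: laurent_of_poly_diff laurent_of_poly_monom laurent_of_poly_1)
    then show ?thesis
      by (simp only: laurent_Q_dvd_iff Q_dvd_iff int_dvd_int_iff mersenne_prod_dvd_iff)
        (simp add: P_dvd_monom_minus_1_iff)
  qed
  show ?thesis
  proof (cases "n \<ge> 0")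
    case True
    then show ?thesis using *[of "nat n"] by simp
  next
    case False
    \<comment> \<open>Negative exponents reduce to positive ones, as the two differences agree up to
      a unit.\<close>
    have "Poly_Mapping.single (- n) 1 - 1 = - (Poly_Mapping.single (- n) 1 * (Poly_Mapping.single n 1 - 1 :: laurent))"
      by (simp add: right_diff_distrib laurent_monomial_inverse)
    then have "laurent_of_poly (Q k) dvd Poly_Mapping.single n 1 - 1 \<longleftrightarrow>
        laurent_of_poly (Q k) dvd Poly_Mapping.single (- n) 1 - 1"
      by (simp only: dvd_minus_iff laurent_dvd_monomial_mult_iff)
    then show ?thesis using *[of "nat (- n)"] False by simp
  qed
qed

lemma P_nonzero: "i \<ge> 1 \<Longrightarrow> P i \<noteq> 0"
  using prime_elem_P[of i] by auto

lemma degree_Q: "Polynomial.degree (Q k) = (\<Sum>i=1..k. Polynomial.degree (P i))"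
  unfolding Q_def by (rule degree_prod_eq_sum_degree) (auto simp: P_nonzero)

lemma degree_Q_le: "Polynomial.degree (Q k) \<le> (\<Sum>i=1..k. nth_prime i)"
  unfolding degree_Q by (intro sum_mono degree_minimal_poly_le[OF field_K card_K \<alpha>_carrier minimal]) auto

lemma Q_nonzero: "Q k \<noteq> 0"
  by (simp add: Q_def P_nonzero)

text \<open>Each \<open>P i\<close> is a nonzero nonunit over a field, hence nonconstant.\<close>

lemma degree_Q_ge: "k \<le> Polynomial.degree (Q k)"
proof -
  have "1 \<le> Polynomial.degree (P i)" if "i \<ge> 1" for i
    using prime_elem_not_unit[OF prime_elem_P[OF that]] P_nonzero[OF that]
    by (metis is_unit_iff_degree less_one linorder_not_less)
  then have "(\<Sum>i=1..k. 1) \<le> Polynomial.degree (Q k)"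
    unfolding degree_Q by (intro sum_mono) auto
  then show ?thesis by simp
qed

lemma laurent_Q_dvd_all_imp_0:
  assumes "\<And>k. k > 0 \<Longrightarrow> laurent_of_poly (Q k) dvd f"
  shows "f = 0"
proof -
  obtain n p where np: "Poly_Mapping.single (int n) 1 * f = laurent_of_poly p"
    using ex_laurent_of_poly by blast
  \<comment> \<open>This choice makes the degree of \<open>Q k\<close> exceed that of
    \<open>p\<close>, so divisibility forces \<open>p = 0\<close>.\<close>
  define k where "k = Suc (Polynomial.degree p)"
  have "laurent_of_poly (Q k) dvd Poly_Mapping.single (int n) 1 * f"
    using assms[of k] by (simp add: k_def)
  then have "Q k dvd p" by (simp only: np laurent_Q_dvd_iff)
  then have "p = 0" using dvd_imp_degree_le[of "Q k" p] degree_Q_ge[of k] by (auto simp: k_def)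
  then have "Poly_Mapping.single (- int n) 1 * (Poly_Mapping.single (int n) 1 * f) = 0"
    by (simp add: np)
  then show ?thesis by (simp only: mult.assoc[symmetric] laurent_monomial_inverse mult_1)
qed

text \<open>Since \<open>X\<close> has finite order modulo \<open>Q\<^sub>k\<close>, negative exponents can be removed.\<close>
lemma ex_reduced_residue:
  "\<exists>r. (\<forall>i\<ge>Polynomial.degree (Q k). Polynomial.coeff r i = 0) \<and> laurent_of_poly (Q k) dvd f - laurent_of_poly r"
proof -
  obtain n p where np: "Poly_Mapping.single (int n) 1 * f = laurent_of_poly p"
    using ex_laurent_of_poly by blast
  define M where "M = mersenne_prod k"
  have M: "M > 0" unfolding M_def by (rule mersenne_prod_pos)
  \<comment> \<open>Since p = X^n f, this is X^(nM) f, which is congruent to \<open>f\<close>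
    because X^M = 1 modulo \<open>Q k\<close>. The subtraction is not truncated, as
    \<open>M > 0\<close>.\<close>
  define g where "g = Polynomial.monom 1 (n * M - n) * p"
  define r where "r = g mod Q k"
  have g: "laurent_of_poly g = Poly_Mapping.single (int (n * M)) 1 * f"
  proof -
    have "int (n * M - n) + int n = int (n * M)" using M by (simp flip: of_nat_add)
    then show ?thesis
      unfolding g_def laurent_of_poly_mult laurent_of_poly_monom np[symmetric] mult.assoc[symmetric]
        laurent_monomial_mult by simp
  qed
  have "laurent_of_poly (Q k) dvd (Poly_Mapping.single (int (n * M)) 1 - 1) * f"
    by (intro dvd_mult2) (simp add: laurent_Q_dvd_monomial_minus_1_iff M_def)
  then have 1: "laurent_of_poly (Q k) dvd laurent_of_poly g - f" by (simp only: g left_diff_distrib mult_1)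
  have 2: "laurent_of_poly (Q k) dvd laurent_of_poly g - laurent_of_poly r"
    unfolding laurent_of_poly_diff[symmetric] laurent_Q_dvd_iff r_def by (rule dvd_minus_mod)
  have "laurent_of_poly (Q k) dvd f - laurent_of_poly r"
    using dvd_diff[OF 2 1] by simp
  moreover have "Polynomial.coeff r i = 0" if "i \<ge> Polynomial.degree (Q k)" for i
    using degree_mod_less[OF Q_nonzero, of g k] that by (auto simp: r_def coeff_eq_0)
  ultimately show ?thesis by blast
qed

end


section \<open>Word lengths in homomorphic images\<close>

context group_hom
begin

lemma foldr_mult_append:
  assumes "set xs \<subseteq> carrier H" "set ys \<subseteq> carrier H"
  shows "foldr (\<otimes>\<^bsub>H\<^esub>) (xs @ ys) \<one>\<^bsub>H\<^esub> = foldr (\<otimes>\<^bsub>H\<^esub>) xs \<one>\<^bsub>H\<^esub> \<otimes>\<^bsub>H\<^esub> foldr (\<otimes>\<^bsub>H\<^esub>) ys \<one>\<^bsub>H\<^esub>"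
proof -
  have closed: "foldr (\<otimes>\<^bsub>H\<^esub>) zs \<one>\<^bsub>H\<^esub> \<in> carrier H" if "set zs \<subseteq> carrier H" for zs
    using that by (induction zs) auto
  show ?thesis
    using assms(1) by (induction xs) (auto simp: H.m_assoc closed assms(2))
qed

text \<open>Ensures that the \<open>LEAST\<close> in \<open>word_length\<close> ranges over a
  nonempty set, so that the minimum is attained.\<close>

lemma ex_word:
  assumes "S \<subseteq> carrier G" "g \<in> generate G S"
  shows "\<exists>ws. set ws \<subseteq> h ` S \<union> m_inv H ` h ` S \<and> foldr (\<otimes>\<^bsub>H\<^esub>) ws \<one>\<^bsub>H\<^esub> = h g"
  using assms(2)
proof (induction rule: generate.induct)
  case one
  show ?case by (intro exI[of _ "[]"]) simp
next
  case (incl s)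
  then show ?case using assms(1) by (intro exI[of _ "[h s]"]) auto
next
  case (inv s)
  then have "s \<in> carrier G" using assms(1) by blast
  then show ?case using inv by (intro exI[of _ "[inv\<^bsub>H\<^esub> h s]"]) auto
next
  case (eng a b)
  then obtain us vs where
    us: "set us \<subseteq> h ` S \<union> m_inv H ` h ` S" "foldr (\<otimes>\<^bsub>H\<^esub>) us \<one>\<^bsub>H\<^esub> = h a" and
    vs: "set vs \<subseteq> h ` S \<union> m_inv H ` h ` S" "foldr (\<otimes>\<^bsub>H\<^esub>) vs \<one>\<^bsub>H\<^esub> = h b" by blast
  have "h ` S \<union> m_inv H ` h ` S \<subseteq> carrier H" using assms(1) by auto
  then have "set us \<subseteq> carrier H" "set vs \<subseteq> carrier H"
    using us(1) vs(1) by (meson order_trans)+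
  then have "foldr (\<otimes>\<^bsub>H\<^esub>) (us @ vs) \<one>\<^bsub>H\<^esub> = h a \<otimes>\<^bsub>H\<^esub> h b"
    using us(2) vs(2) by (simp only: foldr_mult_append)
  also have "\<dots> = h (a \<otimes> b)"
    using eng G.generate_in_carrier[OF assms(1)] by simp
  finally show ?case using us vs by (intro exI[of _ "us @ vs"]) auto
qed

text \<open>Bounds word length in \<open>H\<close> from below by the size of a homomorphism \<open>c\<close> from \<open>G\<close> to the
  integers, which need not factor through \<open>H\<close>.\<close>
lemma ex_lift_of_word:
  fixes c :: "'a \<Rightarrow> int"
  assumes "S \<subseteq> carrier G"
    and c: "\<And>x y. x \<in> carrier G \<Longrightarrow> y \<in> carrier G \<Longrightarrow> c (x \<otimes> y) = c x + c y"
    and L: "\<And>s. s \<in> S \<Longrightarrow> \<bar>c s\<bar> \<le> L"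
    and "set ws \<subseteq> h ` S \<union> m_inv H ` h ` S"
  shows "\<exists>g\<in>carrier G. h g = foldr (\<otimes>\<^bsub>H\<^esub>) ws \<one>\<^bsub>H\<^esub> \<and> \<bar>c g\<bar> \<le> L * int (length ws)"
proof -
  have c_one: "c \<one> = 0" using c[of \<one> \<one>] by simp
  have c_inv: "c (inv x) = - c x" if "x \<in> carrier G" for x
    using c[of x "inv x"] that by (simp add: c_one)
  show ?thesis
    using assms(4)
  proof (induction ws)
    case Nil
    show ?case by (intro bexI[of _ \<one>]) (auto simp: c_one)
  next
    case (Cons w ws)
    then obtain g where g: "g \<in> carrier G" "h g = foldr (\<otimes>\<^bsub>H\<^esub>) ws \<one>\<^bsub>H\<^esub>" "\<bar>c g\<bar> \<le> L * int (length ws)"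
      by auto
    obtain s where s: "s \<in> S" "w = h s \<or> w = inv\<^bsub>H\<^esub> h s" using Cons.prems by auto
    have sG: "s \<in> carrier G" using s assms(1) by blast
    \<comment> \<open>\<open>t\<close> is \<open>s\<close> or its inverse. Since \<open>c\<close>
      changes sign under inversion, the bound \<open>L\<close> holds for both.\<close>
    obtain t where t: "t \<in> carrier G" "w = h t" "\<bar>c t\<bar> \<le> L"
      using s sG L[of s] c_inv[of s] by (metis G.inv_closed abs_minus_cancel hom_inv)
    show ?case
      using g t by (intro bexI[of _ "t \<otimes> g"]) (auto simp: c algebra_simps)
  qed
qed

end

text \<open>Finiteness of \<open>C\<close> bounds the set of distances, so the real supremum is an
  upper bound.\<close>

lemma metric_diam_ge:
  assumes "finite C" "x \<in> C" "y \<in> C"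
  shows "d x y \<le> metric_diam d C"
proof -
  have "(\<lambda>(x, y). d x y) (x, y) \<le> (SUP (x, y)\<in>C \<times> C. d x y)"
    using assms by (intro cSUP_upper) auto
  then show ?thesis by (simp add: metric_diam_def)
qed

section \<open>Sums, principal ideals and cosets over a commutative ring type\<close>

lemma finsum_ring_of_type_algebra:
  "finite A \<Longrightarrow> finsum (ring_of_type_algebra :: 'a :: comm_ring_1 ring) f A = sum f A"
proof -
  interpret cring "ring_of_type_algebra :: 'a ring" by (rule cring_from_type_algebra)
  show "finite A \<Longrightarrow> finsum (ring_of_type_algebra :: 'a ring) f A = sum f A"
  proof (induction A rule: finite_induct)
    case empty
    show ?case by simp (simp add: ring_of_type_algebra_def)
  next
    case (insert x A)
    have "f \<in> B \<rightarrow> carrier (ring_of_type_algebra :: 'a ring)" for B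
      by (simp add: ring_of_type_algebra_def)
    then have "finsum (ring_of_type_algebra :: 'a ring) f (insert x A) =
        f x \<oplus>\<^bsub>ring_of_type_algebra\<^esub> finsum ring_of_type_algebra f A"
      using insert.hyps by (intro finsum_insert) (simp_all add: ring_of_type_algebra_def)
    then show ?case using insert by simp (simp add: ring_of_type_algebra_def)
  qed
qed

lemma genideal_ring_of_type_algebra:
  "x \<in> Idl\<^bsub>ring_of_type_algebra\<^esub> {q} \<longleftrightarrow> q dvd x" for q x :: "'a :: comm_ring_1"
proof -
  interpret cring "ring_of_type_algebra :: 'a ring" by (rule cring_from_type_algebra)
  have "Idl\<^bsub>ring_of_type_algebra\<^esub> {q} = PIdl\<^bsub>ring_of_type_algebra\<^esub> q"
    by (rule cgenideal_eq_genideal[symmetric]) (simp add: ring_of_type_algebra_def)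
  then show ?thesis
    by (auto simp: cgenideal_def ring_of_type_algebra_def dvd_def mult.commute)
qed

lemma a_r_coset_genideal_eq_iff:
  "Idl\<^bsub>ring_of_type_algebra\<^esub> {q} +>\<^bsub>ring_of_type_algebra\<^esub> x = Idl\<^bsub>ring_of_type_algebra\<^esub> {q} +>\<^bsub>ring_of_type_algebra\<^esub> y
    \<longleftrightarrow> q dvd x - y" for q x y :: "'a :: comm_ring_1"
proof -
  interpret cring "ring_of_type_algebra :: 'a ring" by (rule cring_from_type_algebra)
  have carrier: "z \<in> carrier ring_of_type_algebra" for z :: 'a
    by (simp add: ring_of_type_algebra_def)
  have "\<ominus>\<^bsub>ring_of_type_algebra\<^esub> y = - y"
    by (rule minus_equality) (simp_all add: ring_of_type_algebra_def)
  then have "x \<ominus>\<^bsub>ring_of_type_algebra\<^esub> y = x - y"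
    by (simp add: a_minus_def) (simp add: ring_of_type_algebra_def)
  moreover have "ideal (Idl\<^bsub>ring_of_type_algebra\<^esub> {q}) ring_of_type_algebra"
    by (rule genideal_ideal) (simp add: carrier)
  ultimately show ?thesis
    using quotient_eq_iff_same_a_r_cos[of "Idl\<^bsub>ring_of_type_algebra\<^esub> {q}" x y, OF _ carrier carrier]
    by (simp add: genideal_ring_of_type_algebra)
qed


section \<open>Congruence quotients of the lamplighter group\<close>

text \<open>Coordinates on the group as a semidirect product: \<open>n\<close> is the position of
  the lamplighter and \<open>f\<close> the configuration of lamps. The matrix acts as the affine map
  t -> X^n t + f.\<close>

definition lamp :: "int \<Rightarrow> laurent \<Rightarrow> laurent ^ 2 ^ 2" where
  "lamp n f = vector [vector [Poly_Mapping.single n 1, f], vector [0, 1]]"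

lemma lamp_nth [simp]:
  "lamp n f $ 1 $ 1 = Poly_Mapping.single n 1" "lamp n f $ 1 $ 2 = f"
  "lamp n f $ 2 $ 1 = 0" "lamp n f $ 2 $ 2 = 1"
  by (simp_all add: lamp_def)

lemma lamp_eq_iff: "lamp n f = lamp m g \<longleftrightarrow> n = m \<and> f = g"
proof
  assume eq: "lamp n f = lamp m g"
  have "Poly_Mapping.keys (Poly_Mapping.single n (1 :: bit)) = Poly_Mapping.keys (Poly_Mapping.single m (1 :: bit))"
    using arg_cong[OF eq, of "\<lambda>A :: laurent ^ 2 ^ 2. A $ 1 $ 1"] by simp
  then show "n = m \<and> f = g"
    using arg_cong[OF eq, of "\<lambda>A :: laurent ^ 2 ^ 2. A $ 1 $ 2"] by simp
qed auto

lemma mult_mat2_monoid_lamp: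
  "lamp n f \<otimes>\<^bsub>mat2_monoid laurent_ring\<^esub> lamp m g = lamp (n + m) (Poly_Mapping.single n 1 * g + f)"
  by (simp add: mat2_monoid_def finsum_ring_of_type_algebra vec_eq_iff forall_2 sum_2)
    (simp add: ring_of_type_algebra_def laurent_monomial_mult)

lemma one_mat2_monoid_lamp: "\<one>\<^bsub>mat2_monoid laurent_ring\<^esub> = lamp 0 0"
  by (simp add: mat2_monoid_def vec_eq_iff forall_2) (simp add: ring_of_type_algebra_def)

lemma carrier_lamplighter: "carrier lamplighter = {lamp n f | n f. True}"
  by (simp add: lamplighter_def lamp_def)

lemma mult_lamplighter [simp]:
  "lamp n f \<otimes>\<^bsub>lamplighter\<^esub> lamp m g = lamp (n + m) (Poly_Mapping.single n 1 * g + f)"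
  by (simp add: lamplighter_def GL2_def units_of_def mult_mat2_monoid_lamp)

lemma one_lamplighter: "\<one>\<^bsub>lamplighter\<^esub> = lamp 0 0"
  by (simp add: lamplighter_def GL2_def units_of_def one_mat2_monoid_lamp)

lemma lamp_in_carrier [simp]: "lamp n f \<in> carrier lamplighter"
  by (auto simp: carrier_lamplighter)

lemma lamplighter_cases:
  assumes "x \<in> carrier lamplighter"
  obtains n f where "x = lamp n f"
  using assms by (auto simp: carrier_lamplighter)

lemma lamp_inverse:
  "lamp (- n) (- (Poly_Mapping.single (- n) 1 * f)) \<otimes>\<^bsub>lamplighter\<^esub> lamp n f = lamp 0 0"
  "lamp n f \<otimes>\<^bsub>lamplighter\<^esub> lamp (- n) (- (Poly_Mapping.single (- n) 1 * f)) = lamp 0 0"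
  by (simp_all add: mult.assoc[symmetric] laurent_monomial_inverse)

lemma group_lamplighter: "group lamplighter"
proof (rule groupI)
  fix x assume "x \<in> carrier lamplighter"
  then obtain n f where x: "x = lamp n f" by (rule lamplighter_cases)
  show "\<exists>y\<in>carrier lamplighter. y \<otimes>\<^bsub>lamplighter\<^esub> x = \<one>\<^bsub>lamplighter\<^esub>"
    unfolding x one_lamplighter using lamp_inverse(1) lamp_in_carrier by blast
qed (auto simp: carrier_lamplighter one_lamplighter lamp_eq_iff algebra_simps simp flip: laurent_monomial_mult)

lemma inv_lamplighter:
  "inv\<^bsub>lamplighter\<^esub> lamp n f = lamp (- n) (- (Poly_Mapping.single (- n) 1 * f))"
  by (rule group.inv_equality[OF group_lamplighter])
    (simp_all only: lamp_inverse one_lamplighter lamp_in_carrier)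

lemma lamp_in_GL2: "lamp n f \<in> carrier (GL2 laurent_ring)"
proof -
  have carrier: "A \<in> carrier (mat2_monoid laurent_ring)" for A
    by (simp add: mat2_monoid_def ring_of_type_algebra_def)
  define y where "y = lamp (- n) (- (Poly_Mapping.single (- n) 1 * f))"
  have "y \<otimes>\<^bsub>mat2_monoid laurent_ring\<^esub> lamp n f = lamp 0 0"
    "lamp n f \<otimes>\<^bsub>mat2_monoid laurent_ring\<^esub> y = lamp 0 0"
    using lamp_inverse[of n f] unfolding y_def mult_mat2_monoid_lamp mult_lamplighter by simp_all
  then show ?thesis
    using carrier by (auto simp: GL2_def units_of_def Units_def one_mat2_monoid_lamp)
qed

text \<open>The projection of the lamplighter group onto the integers. The description is meaningful
  on \<open>carrier lamplighter\<close>, where \<open>n\<close> is unique by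
  \<open>lamp_eq_iff\<close>.\<close>

definition exponent :: "laurent ^ 2 ^ 2 \<Rightarrow> int" where
  "exponent A = (THE n. \<exists>f. A = lamp n f)"

lemma exponent_lamp [simp]: "exponent (lamp n f) = n"
  by (auto simp: exponent_def lamp_eq_iff)

lemma exponent_mult:
  assumes "x \<in> carrier lamplighter" "y \<in> carrier lamplighter"
  shows "exponent (x \<otimes>\<^bsub>lamplighter\<^esub> y) = exponent x + exponent y"
  using assms by (auto simp: carrier_lamplighter)

text \<open>Congruence to the identity is tested entrywise. The bottom row already agrees with that
  of the identity, so the top row carries both conditions.\<close>

lemma lamp_in_N_subgroup_iff:
  fixes P k
  defines "q \<equiv> laurent_of_poly (\<Prod>i=1..k. P i)"
  shows "lamp n f \<in> N_subgroup P k \<longleftrightarrow> q dvd Poly_Mapping.single n 1 - 1 \<and> q dvd f"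
proof -
  have I: "I_ideal P k = Idl\<^bsub>laurent_ring\<^esub> {q}"
    by (simp add: I_ideal_def q_def laurent_of_poly_prod)
  have zero: "\<zero>\<^bsub>laurent_ring Quot I_ideal P k\<^esub> = I_ideal P k +>\<^bsub>laurent_ring\<^esub> 0"
    by (auto simp: FactRing_def a_r_coset_def r_coset_def ring_of_type_algebra_def)
  have one: "\<one>\<^bsub>laurent_ring Quot I_ideal P k\<^esub> = I_ideal P k +>\<^bsub>laurent_ring\<^esub> 1"
    by (simp add: FactRing_def) (simp add: ring_of_type_algebra_def)
  have "lamp n f \<in> N_subgroup P k \<longleftrightarrow>
      mat2_mod laurent_ring (I_ideal P k) (lamp n f) = \<one>\<^bsub>mat2_monoid (laurent_ring Quot I_ideal P k)\<^esub>"
    by (simp add: N_subgroup_def kernel_def lamp_in_GL2) (simp add: GL2_def units_of_def)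
  also have "\<dots> \<longleftrightarrow> q dvd Poly_Mapping.single n 1 - 1 \<and> q dvd f"
    by (simp add: mat2_mod_def mat2_monoid_def vec_eq_iff forall_2 zero one)
      (simp add: I a_r_coset_genideal_eq_iff)
  finally show ?thesis .
qed

lemma N_subgroup_cases:
  assumes "x \<in> N_subgroup P k"
  obtains n f where "x = lamp n f"
  using assms by (auto simp: N_subgroup_def carrier_lamplighter)

text \<open>Conjugating \<open>lamp m g\<close> by \<open>lamp n f\<close> keeps the exponent
  \<open>m\<close> and turns \<open>g\<close> into X^n g - (X^m - 1) f, where both terms are
  multiples of \<open>q\<close>. Closure under products uses X^(n+m) - 1 = X^n (X^m - 1) + (X^n -
  1).\<close>

lemma normal_N_subgroup: "N_subgroup P k \<lhd> lamplighter"
proof -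
  interpret group lamplighter by (rule group_lamplighter)
  define q where "q = laurent_of_poly (\<Prod>i=1..k. P i)"
  have mem: "lamp n f \<in> N_subgroup P k \<longleftrightarrow> q dvd Poly_Mapping.single n 1 - 1 \<and> q dvd f" for n f
    by (simp add: lamp_in_N_subgroup_iff q_def)
  have carrier: "N_subgroup P k \<subseteq> carrier lamplighter" by (auto simp: N_subgroup_def)
  have subgroup: "subgroup (N_subgroup P k) lamplighter"
  proof (rule subgroupI)
    show "N_subgroup P k \<noteq> {}" using mem[of 0 0] by auto
    show "inv\<^bsub>lamplighter\<^esub> x \<in> N_subgroup P k" if "x \<in> N_subgroup P k" for x
    proof -
      obtain n f where x: "x = lamp n f" using \<open>x \<in> _\<close> by (rule N_subgroup_cases)
      have q: "q dvd Poly_Mapping.single n 1 - 1" "q dvd f" using that by (simp_all add: x mem)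
      have "Poly_Mapping.single (- n) 1 - 1 = - (Poly_Mapping.single (- n) 1 * (Poly_Mapping.single n 1 - 1 :: laurent))"
        by (simp add: right_diff_distrib laurent_monomial_inverse)
      then show ?thesis using q by (simp add: x inv_lamplighter mem)
    qed
    show "x \<otimes>\<^bsub>lamplighter\<^esub> y \<in> N_subgroup P k" if "x \<in> N_subgroup P k" "y \<in> N_subgroup P k" for x y
    proof -
      obtain n f where x: "x = lamp n f" using \<open>x \<in> _\<close> by (rule N_subgroup_cases)
      obtain m g where y: "y = lamp m g" using \<open>y \<in> _\<close> by (rule N_subgroup_cases)
      note xy = x y
      have "Poly_Mapping.single (n + m) 1 - 1 =
          Poly_Mapping.single n 1 * (Poly_Mapping.single m 1 - 1) + (Poly_Mapping.single n 1 - 1 :: laurent)"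
        by (simp add: right_diff_distrib laurent_monomial_mult)
      moreover have "q dvd Poly_Mapping.single n 1 * (Poly_Mapping.single m 1 - 1) + (Poly_Mapping.single n 1 - 1)"
        using that by (intro dvd_add dvd_mult) (simp_all add: xy mem)
      ultimately have "q dvd Poly_Mapping.single (n + m) 1 - 1" by (simp only:)
      then show ?thesis using that by (simp add: xy mem)
    qed
  qed (rule carrier)
  have "x \<otimes>\<^bsub>lamplighter\<^esub> y \<otimes>\<^bsub>lamplighter\<^esub> inv\<^bsub>lamplighter\<^esub> x \<in> N_subgroup P k"
    if "x \<in> carrier lamplighter" "y \<in> N_subgroup P k" for x y
  proof -
    obtain n f where x: "x = lamp n f" using \<open>x \<in> _\<close> by (rule lamplighter_cases)
    obtain m g where y: "y = lamp m g" using \<open>y \<in> _\<close> by (rule N_subgroup_cases)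
    note xy = x y
    have q: "q dvd Poly_Mapping.single m 1 - 1" "q dvd g" using that(2) by (simp_all add: xy mem)
    have cancel: "Poly_Mapping.single (n + m) 1 * (Poly_Mapping.single (- n) 1 * f) = Poly_Mapping.single m 1 * f"
      by (simp add: mult.assoc[symmetric] laurent_monomial_mult)
    have "x \<otimes>\<^bsub>lamplighter\<^esub> y \<otimes>\<^bsub>lamplighter\<^esub> inv\<^bsub>lamplighter\<^esub> x =
        lamp m (Poly_Mapping.single n 1 * g - (Poly_Mapping.single m 1 - 1) * f)"
      by (simp add: xy inv_lamplighter lamp_eq_iff cancel left_diff_distrib)
    then show ?thesis using q by (simp add: mem)
  qed
  then show ?thesis using subgroup by (simp add: normal_inv_iff)
qed

section \<open>Order and diameter of the congruence quotients\<close>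

context congruence_polys
begin

lemma lamp_in_N_iff:
  "lamp n f \<in> N_subgroup P k \<longleftrightarrow> int (mersenne_prod k) dvd n \<and> laurent_of_poly (Q k) dvd f"
  by (simp only: lamp_in_N_subgroup_iff Q_def[symmetric] laurent_Q_dvd_monomial_minus_1_iff)

lemma coset_lamp_eqI:
  assumes "int (mersenne_prod k) dvd n - m" "laurent_of_poly (Q k) dvd f - g"
  shows "N_subgroup P k #>\<^bsub>lamplighter\<^esub> lamp n f = N_subgroup P k #>\<^bsub>lamplighter\<^esub> lamp m g"
proof -
  interpret normal "N_subgroup P k" lamplighter by (rule normal_N_subgroup)
  \<comment> \<open>\<open>h\<close> is \<open>lamp n f\<close> times the inverse of
    \<open>lamp m g\<close>. Its second coordinate is (f - g) - (X^(n-m) - 1) g.\<close>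
  define h where "h = lamp (n - m) (f - Poly_Mapping.single (n - m) 1 * g)"
  have "laurent_of_poly (Q k) dvd (f - g) - (Poly_Mapping.single (n - m) 1 - 1) * g"
    using assms by (intro dvd_diff[OF assms(2)] dvd_mult2) (simp add: laurent_Q_dvd_monomial_minus_1_iff)
  then have h: "h \<in> N_subgroup P k"
    using assms(1) by (simp add: h_def lamp_in_N_iff algebra_simps)
  have "N_subgroup P k #>\<^bsub>lamplighter\<^esub> (h \<otimes>\<^bsub>lamplighter\<^esub> lamp m g) = N_subgroup P k #>\<^bsub>lamplighter\<^esub> lamp m g"
    using h mem_carrier[OF h] subset coset_join2[OF _ subgroup_axioms h]
    by (simp flip: coset_mult_assoc)
  then show ?thesis by (simp add: h_def)
qed

text \<open>The exponent modulo \<open>mersenne_prod k\<close> is well defined on the quotient,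
  which gives its map to a cyclic group.\<close>

lemma coset_lamp_eqD:
  assumes "N_subgroup P k #>\<^bsub>lamplighter\<^esub> lamp n f = N_subgroup P k #>\<^bsub>lamplighter\<^esub> lamp m g"
  shows "int (mersenne_prod k) dvd n - m"
proof -
  interpret normal "N_subgroup P k" lamplighter by (rule normal_N_subgroup)
  have "lamp n f \<in> N_subgroup P k #>\<^bsub>lamplighter\<^esub> lamp m g"
    unfolding assms[symmetric] by (rule rcos_self[OF lamp_in_carrier subgroup_axioms])
  then obtain h where h: "h \<in> N_subgroup P k" "lamp n f = h \<otimes>\<^bsub>lamplighter\<^esub> lamp m g"
    by (auto simp: r_coset_def)
  obtain a b where "h = lamp a b" using mem_carrier[OF h(1)] by (rule lamplighter_cases)
  then show ?thesis using h by (auto simp: lamp_in_N_iff lamp_eq_iff)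
qed

text \<open>Each coset has a representative whose exponent is reduced modulo
  \<open>mersenne_prod k\<close> and whose second coordinate is a polynomial of degree below that of
  \<open>Q k\<close>.\<close>

lemma finite_quotient: "finite (carrier (lamplighter Mod N_subgroup P k))"
  and card_quotient_le:
    "card (carrier (lamplighter Mod N_subgroup P k)) \<le> mersenne_prod k * 2 ^ Polynomial.degree (Q k)"
proof -
  define M where "M = mersenne_prod k"
  define R where "R = {r :: bit poly. \<forall>i\<ge>Polynomial.degree (Q k). Polynomial.coeff r i = 0}"
  define A where "A = {0..<int M} \<times> R"
  have card_R: "card R = 2 ^ Polynomial.degree (Q k)"
    unfolding R_def by (rule card_bit_polys_degree_less)
  have fin: "finite A" using card_ge_0_finite[of R] by (simp add: A_def card_R)
  have sub: "carrier (lamplighter Mod N_subgroup P k) \<subseteq>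
      (\<lambda>(n, r). N_subgroup P k #>\<^bsub>lamplighter\<^esub> lamp n (laurent_of_poly r)) ` A"
  proof
    fix C assume "C \<in> carrier (lamplighter Mod N_subgroup P k)"
    then obtain n f where C: "C = N_subgroup P k #>\<^bsub>lamplighter\<^esub> lamp n f"
      by (auto simp: carrier_FactGroup carrier_lamplighter)
    obtain r where r: "r \<in> R" "laurent_of_poly (Q k) dvd f - laurent_of_poly r"
      using ex_reduced_residue[of k f] by (auto simp: R_def)
    have "C = N_subgroup P k #>\<^bsub>lamplighter\<^esub> lamp (n mod int M) (laurent_of_poly r)"
      unfolding C using r(2) by (intro coset_lamp_eqI) (simp_all add: M_def)
    moreover have "(n mod int M, r) \<in> A"
      using r(1) mersenne_prod_pos[of k] by (simp add: A_def M_def)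
    ultimately show "C \<in> (\<lambda>(n, r). N_subgroup P k #>\<^bsub>lamplighter\<^esub> lamp n (laurent_of_poly r)) ` A"
      by (intro image_eqI[of _ _ "(n mod int M, r)"]) auto
  qed
  show "finite (carrier (lamplighter Mod N_subgroup P k))"
    by (rule finite_surj[OF fin sub])
  have "card (carrier (lamplighter Mod N_subgroup P k)) \<le> card A"
    by (rule surj_card_le[OF fin sub])
  also have "\<dots> = mersenne_prod k * 2 ^ Polynomial.degree (Q k)"
    by (simp add: A_def M_def card_cartesian_product card_R)
  finally show "card (carrier (lamplighter Mod N_subgroup P k)) \<le> mersenne_prod k * 2 ^ Polynomial.degree (Q k)" .
qed

lemma filtration_N_subgroup: "filtration lamplighter (N_subgroup P)"
  unfolding filtration_def
proof (intro conjI allI impI)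
  fix k
  show "N_subgroup P k \<lhd> lamplighter" by (rule normal_N_subgroup)
  show "finite (carrier (lamplighter Mod N_subgroup P k))" by (rule finite_quotient)
  show "N_subgroup P (Suc k) \<subseteq> N_subgroup P k"
  proof
    fix x assume x: "x \<in> N_subgroup P (Suc k)"
    then obtain n f where nf: "x = lamp n f" by (auto simp: N_subgroup_def carrier_lamplighter)
    have "mersenne_prod k dvd mersenne_prod (Suc k)" by (simp add: mersenne_prod_def)
    moreover have "laurent_of_poly (Q k) dvd laurent_of_poly (Q (Suc k))"
      by (simp add: Q_def laurent_of_poly_mult)
    ultimately show "x \<in> N_subgroup P k"
      using x unfolding nf lamp_in_N_iff by (meson dvd_trans int_dvd_int_iff)
  qed
next
  show "(\<Inter>k\<in>{0<..}. N_subgroup P k) = {\<one>\<^bsub>lamplighter\<^esub>}"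
  proof (intro equalityI subsetI)
    fix x assume x: "x \<in> (\<Inter>k\<in>{0<..}. N_subgroup P k)"
    then have "x \<in> N_subgroup P 1" by simp
    then obtain n f where nf: "x = lamp n f" by (auto simp: N_subgroup_def carrier_lamplighter)
    have mem: "int (mersenne_prod k) dvd n" "laurent_of_poly (Q k) dvd f" if "k > 0" for k
      using x that by (auto simp: nf lamp_in_N_iff)
    have "f = 0" using mem(2) by (rule laurent_Q_dvd_all_imp_0)
    moreover have "n = 0"
    proof (rule ccontr)
      assume "n \<noteq> 0"
      \<comment> \<open>Then \<open>mersenne_prod k\<close> exceeds the absolute value of
        \<open>n\<close>, so it cannot divide a nonzero \<open>n\<close>.\<close>
      define k where "k = Suc (nat \<bar>n\<bar>)"
      have "int (mersenne_prod k) \<le> \<bar>n\<bar>"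
        using mem(1)[of k] \<open>n \<noteq> 0\<close> dvd_imp_le_int[of n "int (mersenne_prod k)"] by (simp add: k_def)
      moreover have "k < mersenne_prod k"
        using mersenne_prod_ge[of k] less_exp[of k] by (simp add: k_def)
      ultimately show False by (simp add: k_def)
    qed
    ultimately show "x \<in> {\<one>\<^bsub>lamplighter\<^esub>}" by (simp add: nf one_lamplighter)
  qed (auto simp: one_lamplighter lamp_in_N_iff)
qed

text \<open>The chosen coset lies halfway around the cyclic group of order \<open>M\<close>. A
  shortest word for it lifts to an element of the same coset whose exponent is at most
  \<open>L\<close> times the length, while every lift has exponent at least \<open>M div 2\<close>
  in absolute value.\<close>

lemma mersenne_prod_le_word_length:
  assumes S: "S \<subseteq> carrier lamplighter" "generate lamplighter S = carrier lamplighter"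
    and L: "\<And>s. s \<in> S \<Longrightarrow> \<bar>exponent s\<bar> \<le> int L"
    and k: "k > 0"
  defines "N \<equiv> N_subgroup P k"
  defines "M \<equiv> mersenne_prod k"
  defines "T \<equiv> (\<lambda>s. N #>\<^bsub>lamplighter\<^esub> s) ` S"
  shows "M \<le> 3 * (L * word_length (lamplighter Mod N) T (N #>\<^bsub>lamplighter\<^esub> lamp (int (M div 2)) 0))"
proof -
  interpret normal N lamplighter unfolding N_def by (rule normal_N_subgroup)
  interpret h: group_hom lamplighter "lamplighter Mod N" "\<lambda>g. N #>\<^bsub>lamplighter\<^esub> g"
    using factorgroup_is_group r_coset_hom_Mod
    by (intro group_hom.intro group_hom_axioms.intro group_axioms)
  define C where "C = N #>\<^bsub>lamplighter\<^esub> lamp (int (M div 2)) 0"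
  define l where "l = word_length (lamplighter Mod N) T C"
  have "lamp (int (M div 2)) 0 \<in> generate lamplighter S" by (simp add: S(2))
  then have "\<exists>n ws. length ws = n \<and> set ws \<subseteq> T \<union> m_inv (lamplighter Mod N) ` T \<and>
      foldr (monoid.mult (lamplighter Mod N)) ws \<one>\<^bsub>lamplighter Mod N\<^esub> = C"
    using h.ex_word[OF S(1)] unfolding T_def C_def by blast
  then have "\<exists>ws. length ws = l \<and> set ws \<subseteq> T \<union> m_inv (lamplighter Mod N) ` T \<and>
      foldr (monoid.mult (lamplighter Mod N)) ws \<one>\<^bsub>lamplighter Mod N\<^esub> = C"
    unfolding l_def word_length_def by (rule LeastI_ex)
  then obtain ws where ws: "length ws = l" "set ws \<subseteq> T \<union> m_inv (lamplighter Mod N) ` T"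
    "foldr (monoid.mult (lamplighter Mod N)) ws \<one>\<^bsub>lamplighter Mod N\<^esub> = C" by blast
  obtain g where g: "g \<in> carrier lamplighter" "N #>\<^bsub>lamplighter\<^esub> g = C" "\<bar>exponent g\<bar> \<le> int L * int l"
    using h.ex_lift_of_word[of S exponent "int L" ws] S(1) exponent_mult L ws unfolding T_def by metis
  obtain e f where ef: "g = lamp e f" using g(1) by (rule lamplighter_cases)
  have "int M dvd e - int (M div 2)"
    using g(2) coset_lamp_eqD[of k e f "int (M div 2)" 0] unfolding C_def N_def M_def ef by blast
  then obtain t where t: "e - int (M div 2) = int M * t" by (elim dvdE)
  \<comment> \<open>The integers congruent to \<open>M div 2\<close> modulo \<open>M\<close> are at
    least \<open>M div 2\<close> or at most \<open>M div 2 - M\<close>.\<close>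
  have "int (M div 2) \<le> \<bar>e\<bar>"
  proof (cases "t \<ge> 0")
    case True
    then have "0 \<le> int M * t" by simp
    then show ?thesis using t by linarith
  next
    case False
    then have "int M * t \<le> int M * (- 1)" by (intro mult_left_mono) auto
    then have "e \<le> int (M div 2) - int M" using t by linarith
    then show ?thesis by linarith
  qed
  also have "\<bar>e\<bar> \<le> int (L * l)" using g(3) by (simp add: ef)
  finally have "M div 2 \<le> L * l" by (simp only: of_nat_le_iff)
  \<comment> \<open>Rounding down in \<open>M div 2\<close> costs the constant 3, attained at
    \<open>M = 3\<close>.\<close>
  moreover have "2 < M"
    using mersenne_prod_ge[OF k] power_increasing[of 1 k "2::nat"] k unfolding M_def by simp
  then have "M \<le> 3 * (M div 2)" by presburger
  ultimately have "M \<le> 3 * (L * l)" by linarith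
  then show ?thesis unfolding l_def C_def .
qed

lemma property_D_box_space:
  assumes S: "finite S" "S \<subseteq> carrier lamplighter" "generate lamplighter S = carrier lamplighter"
    and box: "box_space lamplighter S (N_subgroup P) d"
  shows "property_D (1/2) (\<lambda>k. carrier (lamplighter Mod N_subgroup P k)) d"
proof -
  \<comment> \<open>A sum bounds every summand, so no maximum is taken; \<open>Suc\<close> makes
    \<open>L\<close> positive for the division below.\<close>
  define L where "L = Suc (\<Sum>s\<in>S. nat \<bar>exponent s\<bar>)"
  have L: "\<bar>exponent s\<bar> \<le> int L" if "s \<in> S" for s
    using member_le_sum[OF that, of "\<lambda>s. \<bar>exponent s\<bar>"] S(1) by (simp add: L_def)
  have L_pos: "L > 0" by (simp only: L_def zero_less_Suc)
  \<comment> \<open>The constant arises from sqrt(card) \<le> 2 M and M \<le> 3 L diam.\<close>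
  have main: "1 / (6 * real L) * real (card ({k} \<times> carrier (lamplighter Mod N_subgroup P k))) powr (1/2)
      \<le> metric_diam d ({k} \<times> carrier (lamplighter Mod N_subgroup P k))" if k: "k > 0" for k
  proof -
    define M where "M = mersenne_prod k"
    define N where "N = N_subgroup P k"
    define H where "H = lamplighter Mod N"
    define T where "T = (\<lambda>s. N #>\<^bsub>lamplighter\<^esub> s) ` S"
    define C where "C = N #>\<^bsub>lamplighter\<^esub> lamp (int (M div 2)) 0"
    interpret normal N lamplighter unfolding N_def by (rule normal_N_subgroup)
    interpret H: group H unfolding H_def by (rule factorgroup_is_group)
    have C: "C \<in> carrier H" by (auto simp: C_def H_def carrier_FactGroup)
    \<comment> \<open>The box space metric restricts to the word metric on each component, so this
      distance is a word length.\<close>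
    have "d (k, \<one>\<^bsub>H\<^esub>) (k, C) = word_dist H T \<one>\<^bsub>H\<^esub> C"
      using box k C H.one_closed
      unfolding box_space_def coarse_disjoint_union_def H_def T_def N_def by blast
    also have "\<dots> = real (word_length H T C)" using C by (simp add: word_dist_def)
    finally have d: "d (k, \<one>\<^bsub>H\<^esub>) (k, C) = real (word_length H T C)" .
    have "real M \<le> 3 * (real L * real (word_length H T C))"
      using mersenne_prod_le_word_length[OF S(2,3) L k]
      unfolding M_def[symmetric] N_def[symmetric] H_def[symmetric] T_def[symmetric] C_def[symmetric]
      by (metis of_nat_le_iff of_nat_mult of_nat_numeral)
    moreover have "real (word_length H T C) \<le> metric_diam d ({k} \<times> carrier H)"
      unfolding d[symmetric] using C H.one_closed finite_quotient[of k, folded N_def, folded H_def]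
      by (intro metric_diam_ge) auto
    then have "real L * real (word_length H T C) \<le> real L * metric_diam d ({k} \<times> carrier H)"
      by (rule mult_left_mono) simp
    ultimately have diam: "real M \<le> 3 * (real L * metric_diam d ({k} \<times> carrier H))" by linarith
    have "card (carrier H) \<le> M * 2 ^ Polynomial.degree (Q k)"
      unfolding H_def N_def M_def by (rule card_quotient_le)
    also have "(2::nat) ^ Polynomial.degree (Q k) \<le> 2 ^ (\<Sum>i=1..k. nth_prime i)"
      using degree_Q_le by (rule power_increasing) simp
    also have "\<dots> \<le> 2 * M" unfolding M_def by (rule power_sum_nth_prime_le)
    finally have "card (carrier H) \<le> M * (2 * M)" by simp
    then have "real (card (carrier H)) \<le> real (M * (2 * M))" by (simp only: of_nat_le_iff)
    \<comment> \<open>Rounding 2 up to 4 gives a perfect square.\<close>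
    also have "\<dots> \<le> (2 * real M)\<^sup>2" by (simp add: power2_eq_square)
    finally have "sqrt (real (card (carrier H))) \<le> 2 * real M" by (intro real_le_lsqrt) auto
    also have "\<dots> \<le> 6 * real L * metric_diam d ({k} \<times> carrier H)" using diam by simp
    finally have "1 / (6 * real L) * sqrt (real (card (carrier H))) \<le> metric_diam d ({k} \<times> carrier H)"
      using L_pos by (simp add: field_simps)
    then show ?thesis
      by (simp add: card_cartesian_product_singleton powr_half_sqrt H_def N_def)
  qed
  have "1 / (6 * real L) > 0" using L_pos by simp
  then show ?thesis using main unfolding property_D_def by blast
qed

end

text \<open>The metric \<open>d\<close> ranges over all realisations of the coarse disjoint union.
  Property D sees only distances within a component, where they all agree.\<close>

theorem proposition7:
  fixes K :: "nat \<Rightarrow> ('a, 'b) ring_scheme"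
    and \<alpha> :: "nat \<Rightarrow> 'a"
    and P :: "nat \<Rightarrow> bit poly"
    and S :: "(laurent ^ 2 ^ 2) set"
  assumes "\<And>i. i \<ge> 1 \<Longrightarrow> field (K i)"
    and "\<And>i. i \<ge> 1 \<Longrightarrow> card (carrier (K i)) = 2 ^ nth_prime i"
    and "\<And>i. i \<ge> 1 \<Longrightarrow> \<alpha> i \<in> carrier (Multiplicative_Group.mult_of (K i))"
    and "\<And>i. i \<ge> 1 \<Longrightarrow> generate (Multiplicative_Group.mult_of (K i)) {\<alpha> i} = carrier (Multiplicative_Group.mult_of (K i))"
    and "\<And>i. i \<ge> 1 \<Longrightarrow> is_minimal_poly (K i) (\<alpha> i) (P i)"
    and "finite S" "S \<subseteq> carrier lamplighter" "generate lamplighter S = carrier lamplighter"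
  shows "filtration lamplighter (N_subgroup P) \<and>
    (\<forall>d. box_space lamplighter S (N_subgroup P) d \<longrightarrow>
         property_D (1/2) (\<lambda>k. carrier (lamplighter Mod N_subgroup P k)) d)"
proof -
  interpret congruence_polys K \<alpha> P by (rule congruence_polys.intro) (fact assms)+
  show ?thesis
    using filtration_N_subgroup property_D_box_space[OF assms(6-8)] by blast
qed

end
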